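(* A pair of curves $(C_\varphi,C_\psi)$ in Euclidean 3-space $E^3$ with $\tau_\varphi\neq0$ is a Bertrand pair if and only if $$c\,\kappa_\varphi+a\,c\,\tau_\varphi=1,$$ where $a=\cot\theta$, $\theta$ is the angle between the tangents $T_\varphi$ and $T_\psi$ at corresponding points, and $c$ is a constant.
   Context: $C_\varphi$ and $C_\psi$ are the curves given by $\varphi(s)$ and $\psi(s)$ in $E^3$, where $s$ is the arc length of $\varphi$. For a curve with curvature $\kappa$, torsion $\tau$ and Frenet frame $\{\mathbf t,\mathbf n,\mathbf b\}$, the modified orthogonal frame is $T=\mathbf t$, $N=\kappa\mathbf n$, $B=\kappa\mathbf b$. Subscripts $\varphi,\psi$ indicate the curve. Two curves $\varphi,\psi$ with non-vanishing curvatures and torsions form a Bertrand pair $(\varphi,\psi)$ if their normals $N_\varphi$ and $N_\psi$ are parallel (at corresponding points). For a Bertrand pair one writes $\psi(s)=\varphi(s)+\delta(s)N_\varphi(s)$. In that case $\delta=c/\kappa_\varphi$ with $c$ a nonzero real constant, and the angle $\theta$ between $T_\varphi$ and $T_\psi$ is constant; these are the $c$ and $\theta$ that occur in the relation for a Bertrand pair. *)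

theory Defs
  imports "HOL-Analysis.Analysis"
begin

abbreviation velocity :: "(real \<Rightarrow> real^3) \<Rightarrow> real \<Rightarrow> real^3" where
  "velocity f s \<equiv> vector_derivative f (at s)"

text \<open>\<open>C\<^sup>3\<close> is the least regularity for which the torsion is defined. All parameter sets \<open>I\<close>
  are open intervals, so that derivatives \<open>at s\<close> depend only on the curve on \<open>I\<close>.\<close>

definition regular_C3_curve :: "real set \<Rightarrow> (real \<Rightarrow> real^3) \<Rightarrow> bool" where
  "regular_C3_curve I f \<longleftrightarrow>
     f C1_differentiable_on I \<and>
     velocity f C1_differentiable_on I \<and>
     velocity (velocity f) C1_differentiable_on I \<and>
     (\<forall>s\<in>I. velocity f s \<noteq> 0)"

text \<open>Derivative of a vector field \<open>V\<close> along the curve \<open>f\<close> with respect to the arc length of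
  \<open>f\<close>. The curves are not assumed to be parametrised by arc length: in a Bertrand pair both
  curves carry the same parameter, which is the arc length of only the first one.\<close>

definition arc_deriv :: "(real \<Rightarrow> real^3) \<Rightarrow> (real \<Rightarrow> real^3) \<Rightarrow> real \<Rightarrow> real^3" where
  "arc_deriv f V s = vector_derivative V (at s) /\<^sub>R norm (velocity f s)"

definition frenet_t :: "(real \<Rightarrow> real^3) \<Rightarrow> real \<Rightarrow> real^3" where
  "frenet_t f = arc_deriv f f"

definition curvature :: "(real \<Rightarrow> real^3) \<Rightarrow> real \<Rightarrow> real" where
  "curvature f s = norm (arc_deriv f (frenet_t f) s)"

definition frenet_n :: "(real \<Rightarrow> real^3) \<Rightarrow> real \<Rightarrow> real^3" where
  "frenet_n f s = arc_deriv f (frenet_t f) s /\<^sub>R curvature f s"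

definition frenet_b :: "(real \<Rightarrow> real^3) \<Rightarrow> real \<Rightarrow> real^3" where
  "frenet_b f s = cross3 (frenet_t f s) (frenet_n f s)"

text \<open>Sign convention: \<open>db/ds = - \<tau> n\<close>.\<close>

definition torsion :: "(real \<Rightarrow> real^3) \<Rightarrow> real \<Rightarrow> real" where
  "torsion f s = - (arc_deriv f (frenet_b f) s \<bullet> frenet_n f s)"

definition modified_T :: "(real \<Rightarrow> real^3) \<Rightarrow> real \<Rightarrow> real^3" where
  "modified_T f s = frenet_t f s"

definition modified_N :: "(real \<Rightarrow> real^3) \<Rightarrow> real \<Rightarrow> real^3" where
  "modified_N f s = curvature f s *\<^sub>R frenet_n f s"

definition modified_B :: "(real \<Rightarrow> real^3) \<Rightarrow> real \<Rightarrow> real^3" where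
  "modified_B f s = curvature f s *\<^sub>R frenet_b f s"

text \<open>Corresponding points are those with the same parameter.\<close>

definition bertrand_pair :: "real set \<Rightarrow> (real \<Rightarrow> real^3) \<Rightarrow> (real \<Rightarrow> real^3) \<Rightarrow> bool" where
  "bertrand_pair I \<phi> \<psi> \<longleftrightarrow>
     (\<forall>s\<in>I. curvature \<phi> s \<noteq> 0 \<and> torsion \<phi> s \<noteq> 0 \<and> curvature \<psi> s \<noteq> 0 \<and> torsion \<psi> s \<noteq> 0) \<and>
     (\<forall>s\<in>I. \<exists>r. modified_N \<psi> s = r *\<^sub>R modified_N \<phi> s)"

text \<open>\<open>\<theta>\<close> is the angle from \<open>T\<^sub>\<phi>\<close> to \<open>T\<^sub>\<psi>\<close>, oriented in the rectifying plane of \<open>\<phi>\<close> so that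
  \<open>B\<^sub>\<phi>\<close> lies at angle \<open>\<pi>/2\<close>; that is, \<open>T\<^sub>\<psi> = cos \<theta> T\<^sub>\<phi> + sin \<theta> b\<^sub>\<phi>\<close> with the unit binormal
  \<open>b\<^sub>\<phi> = B\<^sub>\<phi> / \<kappa>\<^sub>\<phi>\<close>. The orientation matters: the unoriented angle
  in \<open>[0, \<pi>]\<close> only determines \<open>cot \<theta>\<close> up to sign, and the relation between curvature and
  torsion of a Bertrand pair would fail with it when
  \<open>c \<tau>\<^sub>\<phi> < 0\<close> and \<open>cot \<theta> \<noteq> 0\<close>.\<close>

definition tangent_angle :: "(real \<Rightarrow> real^3) \<Rightarrow> (real \<Rightarrow> real^3) \<Rightarrow> real \<Rightarrow> real \<Rightarrow> bool" where
  "tangent_angle \<phi> \<psi> s \<theta> \<longleftrightarrow>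
     cos \<theta> = modified_T \<phi> s \<bullet> modified_T \<psi> s \<and>
     sin \<theta> = (modified_B \<phi> s /\<^sub>R curvature \<phi> s) \<bullet> modified_T \<psi> s"

end

theory Submission
  imports Defs
begin

text \<open>Write \<open>t, n, b\<close> for the unit Frenet frame of \<open>\<phi>\<close>. If the normals are parallel, then
  \<open>\<psi>'\<close> is orthogonal to \<open>n\<close>, so \<open>(\<psi> - \<phi>) \<bullet> n = \<delta> \<kappa>\<close> is a constant \<open>c\<close> and
  \<open>\<psi>' = (1 - c \<kappa>) t + c \<tau> b\<close>; the components of the unit tangent of \<open>\<psi>\<close> along \<open>t\<close> and \<open>b\<close> have
  vanishing derivative, so they are \<open>cos \<theta>\<close> and \<open>sin \<theta>\<close> for a constant \<open>\<theta>\<close>, and the relation is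
  the proportionality of \<open>(1 - c \<kappa>, c \<tau>)\<close> and \<open>(cos \<theta>, sin \<theta>)\<close>. Conversely, the relation gives
  \<open>\<psi>' = c \<tau> (a t + b)\<close>. Differentiating the orthogonality of the tangent of \<open>\<psi>\<close> to \<open>a b - t\<close> shows
  that the normal of \<open>\<psi>\<close> is a multiple of \<open>n\<close>. Were the torsion of \<open>\<psi>\<close> zero at a point,
  differentiating the orthogonality of that normal to \<open>t\<close> and to \<open>b\<close> would give
  \<open>\<kappa> + a \<tau> = 0\<close> there, whereas the relation says \<open>c (\<kappa> + a \<tau>) = 1\<close>.\<close>

section \<open>Inner products along curves and orthonormal expansions\<close>

lemma has_vector_derivative_inner:
  fixes f g :: "real \<Rightarrow> 'a::real_inner"
  assumes "(f has_vector_derivative f') (at s)" "(g has_vector_derivative g') (at s)"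
  shows "((\<lambda>u. f u \<bullet> g u) has_vector_derivative f s \<bullet> g' + f' \<bullet> g s) (at s)"
  using bounded_bilinear.has_vector_derivative[OF bounded_bilinear_inner assms] .

text \<open>The product rule, evaluated on a constant. This turns each orthogonality or unit-length
  relation below into an equation between derivatives.\<close>

lemma inner_constant_imp_derivative_eq_0:
  fixes f g :: "real \<Rightarrow> 'a::real_inner"
  assumes "open I" "s \<in> I" "\<And>u. u \<in> I \<Longrightarrow> f u \<bullet> g u = k"
    and "(f has_vector_derivative f') (at s)" "(g has_vector_derivative g') (at s)"
  shows "f s \<bullet> g' + f' \<bullet> g s = 0"
proof -
  have "((\<lambda>_. k) has_vector_derivative f s \<bullet> g' + f' \<bullet> g s) (at s)"
    using has_vector_derivative_transform_within_open
      [OF has_vector_derivative_inner[OF assms(4,5)] assms(1,2)] assms(3) by simp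
  then show ?thesis
    using vector_derivative_unique_at has_vector_derivative_const by blast
qed

text \<open>The converse direction: a vanishing derivative gives a single constant because an
  interval is connected.\<close>

lemma inner_constant_on_interval:
  fixes f g :: "real \<Rightarrow> 'a::real_inner"
  assumes "is_interval I"
    and "\<And>s. s \<in> I \<Longrightarrow> (f has_vector_derivative f' s) (at s)"
    and "\<And>s. s \<in> I \<Longrightarrow> (g has_vector_derivative g' s) (at s)"
    and "\<And>s. s \<in> I \<Longrightarrow> f s \<bullet> g' s + f' s \<bullet> g s = 0"
  obtains k where "\<And>s. s \<in> I \<Longrightarrow> f s \<bullet> g s = k"
proof -
  have "((\<lambda>u. f u \<bullet> g u) has_field_derivative 0) (at s within I)" if "s \<in> I" for s
    using has_vector_derivative_inner[OF assms(2,3)[OF that]] assms(4)[OF that]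
    by (simp add: has_real_derivative_iff_has_vector_derivative has_vector_derivative_at_within)
  then show thesis
    using has_field_derivative_zero_constant[of I "\<lambda>u. f u \<bullet> g u"] assms(1) that
    by (auto simp: is_interval_convex_1)
qed

lemma orthonormal_cross3_expansion:
  fixes t n x :: "real^3"
  assumes "t \<bullet> t = 1" "n \<bullet> n = 1" "t \<bullet> n = 0"
  shows "x = (x \<bullet> t) *\<^sub>R t + (x \<bullet> n) *\<^sub>R n + (x \<bullet> cross3 t n) *\<^sub>R cross3 t n"
proof -
  define b where "b = cross3 t n"
  have bt: "b \<bullet> t = 0" and bn: "b \<bullet> n = 0"
    by (simp_all add: b_def dot_cross_self)
  have "(norm b)\<^sup>2 = 1"
    using norm_cross_dot[of t n] assms by (simp add: b_def norm_eq_sqrt_inner)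
  then have bb: "b \<bullet> b = 1" by (simp add: power2_norm_eq_inner)
  define d where "d = x - ((x \<bullet> t) *\<^sub>R t + (x \<bullet> n) *\<^sub>R n + (x \<bullet> b) *\<^sub>R b)"
  have dt: "d \<bullet> t = 0" "d \<bullet> n = 0" "d \<bullet> b = 0"
    using assms bt bn bb by (simp_all add: d_def inner_simps inner_commute)
  \<comment> \<open>The residual \<open>d\<close> is orthogonal to \<open>t\<close> and
    \<open>n\<close>, so \<open>cross3 d b = 0\<close>. It is also orthogonal to the unit vector
    \<open>b\<close>, and \<open>|d x b|^2 + (d . b)^2 = |d|^2 |b|^2\<close> then forces
    \<open>d = 0\<close>.\<close>
  have "cross3 d b = (d \<bullet> n) *\<^sub>R t - (d \<bullet> t) *\<^sub>R n"
    unfolding b_def by (rule Lagrange)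
  then have "d = 0"
    using norm_cross_dot[of d b] dt bb by (simp add: norm_eq_sqrt_inner)
  then show ?thesis by (simp add: d_def b_def)
qed

lemma differentiable_inverse_norm:
  fixes f :: "real \<Rightarrow> 'a::real_inner"
  assumes "f differentiable at s" "f s \<noteq> 0"
  shows "(\<lambda>u. inverse (norm (f u))) differentiable at s"
  using assms differentiable_compose[OF differentiable_norm_at[OF assms(2)] assms(1)]
  by (intro differentiable_inverse) auto

lemma differentiable_transform_within_open:
  fixes f g :: "real \<Rightarrow> 'a::real_normed_vector"
  assumes "f differentiable at s" "open I" "s \<in> I" "\<And>u. u \<in> I \<Longrightarrow> f u = g u"
  shows "g differentiable at s"
  using has_derivative_transform_within_open[of f _ s UNIV, OF _ assms(2-4)] assms(1)
  unfolding differentiable_def by blast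

section \<open>Frenet frame and Frenet equations at arbitrary speed\<close>

locale frenet_curve =
  fixes I :: "real set" and f :: "real \<Rightarrow> real^3"
  assumes open_I: "open I"
    and regular: "regular_C3_curve I f"
    and curvature_nonzero: "\<And>s. s \<in> I \<Longrightarrow> curvature f s \<noteq> 0"
begin

abbreviation "v s \<equiv> norm (velocity f s)"
abbreviation "t \<equiv> frenet_t f"
abbreviation "n \<equiv> frenet_n f"
abbreviation "b \<equiv> frenet_b f"
abbreviation "\<kappa> \<equiv> curvature f"
abbreviation "\<tau> \<equiv> torsion f"

lemma speed_pos: "s \<in> I \<Longrightarrow> v s > 0"
  using regular by (auto simp: regular_C3_curve_def)

lemma velocity_eq: "s \<in> I \<Longrightarrow> velocity f s = v s *\<^sub>R t s"
  using speed_pos[of s] by (simp add: frenet_t_def arc_deriv_def)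

lemma curve_deriv: "s \<in> I \<Longrightarrow> (f has_vector_derivative v s *\<^sub>R t s) (at s)"
  using regular velocity_eq[of s] vector_derivative_works[of f "at s"]
  by (auto simp: regular_C3_curve_def C1_differentiable_on_eq)

lemma t_unit: "s \<in> I \<Longrightarrow> t s \<bullet> t s = 1"
  using speed_pos[of s]
  by (simp add: frenet_t_def arc_deriv_def dot_square_norm power2_eq_square)

lemma n_unit: "s \<in> I \<Longrightarrow> n s \<bullet> n s = 1"
  using curvature_nonzero[of s]
  by (simp add: frenet_n_def curvature_def dot_square_norm power2_eq_square)

lemma velocity_differentiable:
  "s \<in> I \<Longrightarrow> velocity f differentiable at s"
  "s \<in> I \<Longrightarrow> velocity (velocity f) differentiable at s"
  using regular by (auto simp: regular_C3_curve_def C1_differentiable_on_eq)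

lemma t_differentiable: "s \<in> I \<Longrightarrow> t differentiable at s"
  unfolding frenet_t_def arc_deriv_def
  using speed_pos[of s]
  by (intro differentiable_scaleR differentiable_inverse_norm velocity_differentiable) auto

lemma t_deriv:
  assumes "s \<in> I" shows "(t has_vector_derivative (v s * \<kappa> s) *\<^sub>R n s) (at s)"
proof -
  have "velocity t s = (v s * \<kappa> s) *\<^sub>R n s"
    using speed_pos[OF assms] curvature_nonzero[OF assms]
    by (simp add: frenet_n_def arc_deriv_def field_simps)
  then show ?thesis
    using t_differentiable[OF assms] vector_derivative_works by metis
qed

lemma t_inner_n:
  assumes "s \<in> I" shows "t s \<bullet> n s = 0"
  using inner_constant_imp_derivative_eq_0[OF open_I assms t_unit t_deriv[OF assms] t_deriv[OF assms]]
    speed_pos[OF assms] curvature_nonzero[OF assms]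
  by (auto simp: inner_commute)

lemma b_inner: "b s \<bullet> t s = 0" "b s \<bullet> n s = 0"
  by (simp_all add: frenet_b_def dot_cross_self)

lemma b_unit:
  assumes "s \<in> I" shows "b s \<bullet> b s = 1"
  using norm_cross_dot[of "t s" "n s"] assms
  by (simp add: frenet_b_def t_inner_n power_mult_distrib power2_norm_eq_inner t_unit n_unit)

lemma frame_inner:
  assumes "s \<in> I"
  shows "t s \<bullet> t s = 1" "n s \<bullet> n s = 1" "b s \<bullet> b s = 1"
    "t s \<bullet> n s = 0" "n s \<bullet> t s = 0"
    "t s \<bullet> b s = 0" "b s \<bullet> t s = 0" "n s \<bullet> b s = 0" "b s \<bullet> n s = 0"
  using assms b_inner[of s] t_inner_n[of s] by (simp_all add: t_unit n_unit b_unit inner_commute)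

lemma frame_expansion:
  "s \<in> I \<Longrightarrow> x = (x \<bullet> t s) *\<^sub>R t s + (x \<bullet> n s) *\<^sub>R n s + (x \<bullet> b s) *\<^sub>R b s"
  unfolding frenet_b_def
  by (rule orthonormal_cross3_expansion) (simp_all add: t_unit n_unit t_inner_n)

text \<open>Differentiating \<open>t = g f'\<close> with \<open>g = 1 / |f'|\<close> brings in \<open>g'\<close>, about which only existence is
  known; orthogonality to \<open>t\<close> eliminates it.\<close>

lemma t_velocity_eq:
  assumes "s \<in> I"
  shows "velocity t s = inverse (v s) *\<^sub>R
    (velocity (velocity f) s - (velocity (velocity f) s \<bullet> t s) *\<^sub>R t s)"
proof -
  let ?a = "velocity (velocity f) s"
  let ?g = "\<lambda>u. inverse (v u)"
  obtain g' where g': "(?g has_field_derivative g') (at s)"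
    using differentiable_inverse_norm[OF velocity_differentiable(1)[OF assms]] speed_pos[OF assms]
    by (auto simp: real_differentiable_def)
  have "(velocity f has_vector_derivative ?a) (at s)"
    using velocity_differentiable(1)[OF assms] vector_derivative_works by blast
  from has_vector_derivative_scaleR[OF g' this]
  have d: "(t has_vector_derivative ?g s *\<^sub>R ?a + g' *\<^sub>R velocity f s) (at s)"
    by (simp add: frenet_t_def arc_deriv_def[abs_def])
  have "t s \<bullet> (?g s *\<^sub>R ?a + g' *\<^sub>R velocity f s) = 0"
    using inner_constant_imp_derivative_eq_0[OF open_I assms t_unit d d]
    by (simp add: inner_commute)
  moreover have "t s \<bullet> velocity f s = v s"
    using arg_cong[OF velocity_eq[OF assms], of "\<lambda>x. t s \<bullet> x"] t_unit[OF assms] by simp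
  ultimately have "g' * v s = - ?g s * (?a \<bullet> t s)"
    by (simp add: inner_simps inner_commute add_eq_0_iff)
  moreover have "velocity t s = ?g s *\<^sub>R ?a + (g' * v s) *\<^sub>R t s"
    using vector_derivative_at[OF d] velocity_eq[OF assms] by (metis scaleR_scaleR)
  ultimately show ?thesis by (simp add: algebra_simps)
qed

text \<open>Third-order regularity enters here: \<open>t_velocity_eq\<close> writes the derivative
  of \<open>t\<close> through the second derivative of \<open>f\<close>, which is itself
  differentiable. That formula holds only on \<open>I\<close>, hence the transfer along an open
  set.\<close>

lemma n_differentiable:
  assumes "s \<in> I" shows "n differentiable at s"
proof -
  let ?K = "\<lambda>u. inverse (v u) *\<^sub>R (inverse (v u) *\<^sub>R
    (velocity (velocity f) u - (velocity (velocity f) u \<bullet> t u) *\<^sub>R t u))"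
  have "?K differentiable at s"
    using speed_pos[OF assms] velocity_differentiable[OF assms] t_differentiable[OF assms]
    by (intro differentiable_scaleR differentiable_inverse_norm differentiable_diff
        differentiable_inner) auto
  moreover have "?K u = arc_deriv f t u" if "u \<in> I" for u
    using t_velocity_eq[OF that] by (simp add: arc_deriv_def)
  ultimately have "arc_deriv f t differentiable at s"
    by (rule differentiable_transform_within_open[OF _ open_I assms])
  then show ?thesis
    using curvature_nonzero[OF assms]
    unfolding frenet_n_def[abs_def] curvature_def
    by (intro differentiable_scaleR differentiable_inverse_norm) auto
qed

lemma b_deriv_exists:
  assumes "s \<in> I" shows "(b has_vector_derivative velocity b s) (at s)"
proof -
  have "bounded_bilinear cross3"
    using bilinear_cross by (simp add: bilinear_conv_bounded_bilinear)
  moreover have "(n has_vector_derivative velocity n s) (at s)"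
    using n_differentiable[OF assms] vector_derivative_works by blast
  ultimately have "b differentiable at s"
    unfolding frenet_b_def[abs_def]
    using differentiableI_vector bounded_bilinear.has_vector_derivative t_deriv[OF assms] by blast
  then show ?thesis using vector_derivative_works by blast
qed

text \<open>The components along \<open>n\<close>, \<open>t\<close> and \<open>b\<close> come from
  differentiating \<open>n . n = 1\<close>, \<open>t . n = 0\<close> and \<open>b . n = 0\<close>;
  the last one brings in the definition of torsion. The factor \<open>v s\<close> accounts for the
  parameter not being arc length.\<close>

lemma n_deriv:
  assumes "s \<in> I"
  shows "(n has_vector_derivative v s *\<^sub>R (\<tau> s *\<^sub>R b s - \<kappa> s *\<^sub>R t s)) (at s)"
proof -
  have d: "(n has_vector_derivative velocity n s) (at s)"
    using n_differentiable[OF assms] vector_derivative_works by blast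
  have "velocity n s \<bullet> n s = 0"
    using inner_constant_imp_derivative_eq_0[OF open_I assms n_unit d d] by (simp add: inner_commute)
  moreover have "velocity n s \<bullet> t s = - (v s * \<kappa> s)"
    using inner_constant_imp_derivative_eq_0[OF open_I assms t_inner_n t_deriv[OF assms] d]
      n_unit[OF assms] by (simp add: inner_commute)
  moreover have "velocity n s \<bullet> b s = v s * \<tau> s"
    using inner_constant_imp_derivative_eq_0[OF open_I assms b_inner(2) b_deriv_exists[OF assms] d]
      speed_pos[OF assms] by (simp add: inner_commute torsion_def arc_deriv_def add_eq_0_iff)
  ultimately have "velocity n s = v s *\<^sub>R (\<tau> s *\<^sub>R b s - \<kappa> s *\<^sub>R t s)"
    using frame_expansion[OF assms, of "velocity n s"] by (simp add: algebra_simps)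
  with d show ?thesis by simp
qed

lemma b_deriv:
  assumes "s \<in> I"
  shows "(b has_vector_derivative - (v s * \<tau> s) *\<^sub>R n s) (at s)"
proof -
  note d = b_deriv_exists[OF assms]
  have "velocity b s \<bullet> b s = 0"
    using inner_constant_imp_derivative_eq_0[OF open_I assms b_unit d d] by (simp add: inner_commute)
  moreover have "velocity b s \<bullet> t s = 0"
    using inner_constant_imp_derivative_eq_0[OF open_I assms b_inner(1) d t_deriv[OF assms]]
      b_inner[of s] by (simp add: inner_commute)
  moreover have "velocity b s \<bullet> n s = - (v s * \<tau> s)"
    using speed_pos[OF assms] by (simp add: torsion_def arc_deriv_def)
  ultimately have "velocity b s = - (v s * \<tau> s) *\<^sub>R n s"
    using frame_expansion[OF assms, of "velocity b s"] by simp
  with d show ?thesis by simp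
qed

end


section \<open>Curves displaced along the normal, and both directions of the equivalence\<close>

locale offset_curves = \<phi>: frenet_curve I \<phi> + \<psi>: frenet_curve I \<psi>
  for I :: "real set" and \<phi> \<psi> :: "real \<Rightarrow> real^3" +
  fixes \<delta> :: "real \<Rightarrow> real"
  assumes interval: "is_interval I"
    and arc_length: "\<And>s. s \<in> I \<Longrightarrow> norm (velocity \<phi> s) = 1"
    and torsion_nonzero: "\<And>s. s \<in> I \<Longrightarrow> torsion \<phi> s \<noteq> 0"
    and offset: "\<And>s. s \<in> I \<Longrightarrow> \<psi> s = \<phi> s + \<delta> s *\<^sub>R modified_N \<phi> s"
begin

text \<open>Since \<open>N = \<kappa> n\<close>, the assumption makes
  \<open>\<psi> = \<phi> + c n\<close> on \<open>I\<close>, and the Frenet equation for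
  \<open>n\<close> applies.\<close>

lemma constant_offset_velocity:
  assumes "\<And>s. s \<in> I \<Longrightarrow> \<delta> s * curvature \<phi> s = c" and "s \<in> I"
  shows "velocity \<psi> s =
    (1 - c * curvature \<phi> s) *\<^sub>R frenet_t \<phi> s + (c * torsion \<phi> s) *\<^sub>R frenet_b \<phi> s"
proof -
  have "\<phi> u + c *\<^sub>R frenet_n \<phi> u = \<psi> u" if "u \<in> I" for u
    using offset[OF that] assms(1)[OF that] by (simp add: modified_N_def)
  moreover have "((\<lambda>u. \<phi> u + c *\<^sub>R frenet_n \<phi> u) has_vector_derivative
      frenet_t \<phi> s + c *\<^sub>R (torsion \<phi> s *\<^sub>R frenet_b \<phi> s - curvature \<phi> s *\<^sub>R frenet_t \<phi> s)) (at s)"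
    using \<phi>.curve_deriv[OF assms(2)] \<phi>.n_deriv[OF assms(2)] arc_length[OF assms(2)]
    by (auto intro!: derivative_eq_intros)
  ultimately show ?thesis
    using vector_derivative_at has_vector_derivative_transform_within_open \<phi>.open_I assms(2)
    by (fastforce simp: algebra_simps)
qed

lemma parallel_normals_imp:
  assumes parallel: "\<And>s. s \<in> I \<Longrightarrow> \<exists>k. frenet_n \<psi> s = k *\<^sub>R frenet_n \<phi> s"
    and distinct: "\<exists>s\<in>I. \<psi> s \<noteq> \<phi> s"
  shows "\<exists>c \<theta>. c \<noteq> 0 \<and> sin \<theta> \<noteq> 0 \<and>
    (\<forall>s\<in>I. \<delta> s = c / curvature \<phi> s \<and> tangent_angle \<phi> \<psi> s \<theta> \<and>
      c * curvature \<phi> s + cot \<theta> * c * torsion \<phi> s = 1)"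
proof -
  have orth: "frenet_t \<psi> s \<bullet> frenet_n \<phi> s = 0" "frenet_n \<psi> s \<bullet> frenet_t \<phi> s = 0"
    "frenet_n \<psi> s \<bullet> frenet_b \<phi> s = 0" if s: "s \<in> I" for s
  proof -
    obtain k where k: "frenet_n \<psi> s = k *\<^sub>R frenet_n \<phi> s" using parallel[OF s] by blast
    with \<psi>.n_unit[OF s] have "k \<noteq> 0" by auto
    with k \<psi>.frame_inner[OF s] show "frenet_t \<psi> s \<bullet> frenet_n \<phi> s = 0"
      by (metis inner_scaleR_right mult_eq_0_iff)
    show "frenet_n \<psi> s \<bullet> frenet_t \<phi> s = 0" "frenet_n \<psi> s \<bullet> frenet_b \<phi> s = 0"
      using k \<phi>.frame_inner[OF s] by simp_all
  qed
  \<comment> \<open>No differentiability of \<open>\<delta>\<close> is assumed, so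
    \<open>\<delta> \<kappa>\<close> is studied as this inner product of differentiable fields. Its
    derivative vanishes: both tangents are orthogonal to the normal of \<phi>, and the displacement
    is parallel to that normal, hence orthogonal to its derivative.\<close>
  have mu: "(\<psi> s - \<phi> s) \<bullet> frenet_n \<phi> s = \<delta> s * curvature \<phi> s" if "s \<in> I" for s
    using offset[OF that] \<phi>.n_unit[OF that] by (simp add: modified_N_def)
  have "((\<lambda>u. \<psi> u - \<phi> u) has_vector_derivative
      norm (velocity \<psi> s) *\<^sub>R frenet_t \<psi> s - frenet_t \<phi> s) (at s)" if "s \<in> I" for s
    using \<psi>.curve_deriv[OF that] \<phi>.curve_deriv[OF that] arc_length[OF that]
    by (auto intro!: derivative_eq_intros)
  then obtain c where "\<And>s. s \<in> I \<Longrightarrow> (\<psi> s - \<phi> s) \<bullet> frenet_n \<phi> s = c"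
    by (rule inner_constant_on_interval[OF interval _ \<phi>.n_deriv])
      (simp_all add: offset modified_N_def orth \<phi>.frame_inner inner_simps)
  with mu have c: "\<delta> s * curvature \<phi> s = c" if "s \<in> I" for s using that by simp
  \<comment> \<open>If \<open>c\<close> were zero, \<open>\<delta>\<close> would vanish on
    \<open>I\<close> and the curves would coincide.\<close>
  have c0: "c \<noteq> 0"
    using distinct offset c \<phi>.curvature_nonzero by (fastforce simp: modified_N_def)
  have vel: "velocity \<psi> s =
      (1 - c * curvature \<phi> s) *\<^sub>R frenet_t \<phi> s + (c * torsion \<phi> s) *\<^sub>R frenet_b \<phi> s"
    if "s \<in> I" for s
    using constant_offset_velocity c that by blast
  \<comment> \<open>By the Frenet equations every term in the derivatives of these two products
    contains a factor from \<open>orth\<close>.\<close>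
  obtain p where p: "\<And>s. s \<in> I \<Longrightarrow> frenet_t \<psi> s \<bullet> frenet_t \<phi> s = p"
    by (rule inner_constant_on_interval[OF interval \<psi>.t_deriv \<phi>.t_deriv]) (simp_all add: orth)
  obtain q where q: "\<And>s. s \<in> I \<Longrightarrow> frenet_t \<psi> s \<bullet> frenet_b \<phi> s = q"
    by (rule inner_constant_on_interval[OF interval \<psi>.t_deriv \<phi>.b_deriv]) (simp_all add: orth)
  have vp: "norm (velocity \<psi> s) * p = 1 - c * curvature \<phi> s"
    and vq: "norm (velocity \<psi> s) * q = c * torsion \<phi> s" if s: "s \<in> I" for s
    using arg_cong[OF vel[OF s], of "\<lambda>x. x \<bullet> frenet_t \<phi> s"]
      arg_cong[OF vel[OF s], of "\<lambda>x. x \<bullet> frenet_b \<phi> s"] \<psi>.velocity_eq[OF s] p[OF s] q[OF s]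
    by (simp_all add: inner_simps \<phi>.frame_inner[OF s]) (metis inner_scaleR_left)+
  obtain s0 where s0: "s0 \<in> I" using distinct by blast
  \<comment> \<open>This becomes \<open>sin \<theta> \<noteq> 0\<close>, so that
    \<open>cot \<theta>\<close> is a genuine quotient.\<close>
  have "q \<noteq> 0" using vq[OF s0] c0 torsion_nonzero[OF s0] by auto
  have "p\<^sup>2 + q\<^sup>2 = 1"
    using arg_cong[OF \<phi>.frame_expansion[OF s0, of "frenet_t \<psi> s0"], of "\<lambda>x. frenet_t \<psi> s0 \<bullet> x"]
    by (simp add: inner_simps \<psi>.t_unit s0 p q orth power2_eq_square)
  then obtain \<theta> where \<theta>: "p = cos \<theta>" "q = sin \<theta>"
    using sincos_total_2pi by blast
  have "c * curvature \<phi> s + cot \<theta> * c * torsion \<phi> s = 1" if "s \<in> I" for s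
  proof -
    have "cot \<theta> * (c * torsion \<phi> s) = norm (velocity \<psi> s) * p"
      using \<open>q \<noteq> 0\<close> by (simp add: vq[OF that, symmetric] \<theta> cot_def)
    then show ?thesis using vp[OF that] by (simp add: algebra_simps)
  qed
  moreover have "tangent_angle \<phi> \<psi> s \<theta>" if "s \<in> I" for s
    using p[OF that] q[OF that] \<phi>.curvature_nonzero[OF that]
    by (simp add: tangent_angle_def modified_T_def modified_B_def \<theta> inner_commute)
  moreover have "\<delta> s = c / curvature \<phi> s" if "s \<in> I" for s
    using c[OF that] \<phi>.curvature_nonzero[OF that] by (simp add: field_simps)
  ultimately show ?thesis using c0 \<open>q \<noteq> 0\<close> \<theta> by blast
qed

text \<open>Stated for an arbitrary real \<open>a\<close>, so that it yields both the backward
  direction, with \<open>a = cot \<theta>\<close>, and the second conjunct of the theorem.\<close>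

lemma linear_relation_imp_bertrand:
  assumes c: "c \<noteq> 0" "\<And>s. s \<in> I \<Longrightarrow> \<delta> s = c / curvature \<phi> s"
    and rel: "\<And>s. s \<in> I \<Longrightarrow> c * curvature \<phi> s + a * c * torsion \<phi> s = 1"
  shows "bertrand_pair I \<phi> \<psi>"
proof -
  have vel: "norm (velocity \<psi> s) *\<^sub>R frenet_t \<psi> s =
      (c * torsion \<phi> s) *\<^sub>R (a *\<^sub>R frenet_t \<phi> s + frenet_b \<phi> s)" if s: "s \<in> I" for s
  proof -
    have "velocity \<psi> s =
      (1 - c * curvature \<phi> s) *\<^sub>R frenet_t \<phi> s + (c * torsion \<phi> s) *\<^sub>R frenet_b \<phi> s"
      using constant_offset_velocity[of c] c(2) \<phi>.curvature_nonzero s by simp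
    moreover have "1 - c * curvature \<phi> s = c * torsion \<phi> s * a"
      using rel[OF s] by (simp add: algebra_simps)
    ultimately show ?thesis using \<psi>.velocity_eq[OF s] by (simp add: scaleR_add_right)
  qed
  \<comment> \<open>By \<open>vel\<close> the tangent of \<psi> is parallel to
    \<open>a t + b\<close>, whose orthogonal complement is spanned by \<open>n\<close> and
    \<open>a b - t\<close>.\<close>
  have t_inner: "frenet_t \<psi> s \<bullet> frenet_n \<phi> s = 0"
    "frenet_t \<psi> s \<bullet> (a *\<^sub>R frenet_b \<phi> s - frenet_t \<phi> s) = 0"
    "frenet_t \<psi> s \<bullet> frenet_t \<phi> s = a * (frenet_t \<psi> s \<bullet> frenet_b \<phi> s)" if s: "s \<in> I" for s
  proof -
    have "norm (velocity \<psi> s) * (frenet_t \<psi> s \<bullet> x) =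
        c * torsion \<phi> s * ((a *\<^sub>R frenet_t \<phi> s + frenet_b \<phi> s) \<bullet> x)" for x
      using arg_cong[OF vel[OF s], of "\<lambda>y. y \<bullet> x"] by simp
    from this[of "frenet_n \<phi> s"] this[of "a *\<^sub>R frenet_b \<phi> s - frenet_t \<phi> s"]
    show "frenet_t \<psi> s \<bullet> frenet_n \<phi> s = 0"
      "frenet_t \<psi> s \<bullet> (a *\<^sub>R frenet_b \<phi> s - frenet_t \<phi> s) = 0"
      using \<psi>.speed_pos[OF s] by (simp_all add: inner_simps \<phi>.frame_inner[OF s])
    then show "frenet_t \<psi> s \<bullet> frenet_t \<phi> s = a * (frenet_t \<psi> s \<bullet> frenet_b \<phi> s)"
      by (simp add: inner_simps)
  qed
  have n_inner: "frenet_n \<psi> s \<bullet> frenet_t \<phi> s = 0" "frenet_n \<psi> s \<bullet> frenet_b \<phi> s = 0"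
    if s: "s \<in> I" for s
  proof -
    \<comment> \<open>The derivative of \<open>a b - t\<close> is a multiple of \<open>n\<close>,
      thus orthogonal to the tangent of \<psi>; only the term with the normal of \<psi>
      survives.\<close>
    have "((\<lambda>u. a *\<^sub>R frenet_b \<phi> u - frenet_t \<phi> u) has_vector_derivative
        - (a * torsion \<phi> s + curvature \<phi> s) *\<^sub>R frenet_n \<phi> s) (at s)"
      using \<phi>.b_deriv[OF s] \<phi>.t_deriv[OF s] arc_length[OF s]
      by (auto intro!: derivative_eq_intros simp: algebra_simps)
    from inner_constant_imp_derivative_eq_0[OF \<phi>.open_I s t_inner(2) \<psi>.t_deriv[OF s] this]
    have "frenet_n \<psi> s \<bullet> (a *\<^sub>R frenet_b \<phi> s - frenet_t \<phi> s) = 0"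
      using t_inner(1)[OF s] \<psi>.speed_pos[OF s] \<psi>.curvature_nonzero[OF s] by simp
    then have 1: "frenet_n \<psi> s \<bullet> frenet_t \<phi> s = a * (frenet_n \<psi> s \<bullet> frenet_b \<phi> s)"
      by (simp add: inner_simps)
    \<comment> \<open>Orthogonality of tangent and normal of \<psi> gives a second linear equation
      for the two components; with the first, only the zero solution remains since
      \<open>a * a + 1 > 0\<close>.\<close>
    have "a * (frenet_n \<psi> s \<bullet> frenet_t \<phi> s) + frenet_n \<psi> s \<bullet> frenet_b \<phi> s = 0"
      using arg_cong[OF vel[OF s], of "\<lambda>y. frenet_n \<psi> s \<bullet> y"] c(1) torsion_nonzero[OF s]
      by (simp add: inner_simps \<psi>.frame_inner[OF s])
    then have "(a * a + 1) * (frenet_n \<psi> s \<bullet> frenet_b \<phi> s) = 0"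
      unfolding 1 by (simp add: algebra_simps)
    moreover have "a * a + 1 > 0" using zero_le_square[of a] by linarith
    ultimately show "frenet_n \<psi> s \<bullet> frenet_b \<phi> s = 0" by simp
    with 1 show "frenet_n \<psi> s \<bullet> frenet_t \<phi> s = 0" by simp
  qed
  define k where "k s = frenet_n \<psi> s \<bullet> frenet_n \<phi> s" for s
  have k: "frenet_n \<psi> s = k s *\<^sub>R frenet_n \<phi> s" if "s \<in> I" for s
    using \<phi>.frame_expansion[OF that, of "frenet_n \<psi> s"] by (simp add: n_inner that k_def)
  have "torsion \<psi> s \<noteq> 0" if s: "s \<in> I" for s
  proof
    assume "torsion \<psi> s = 0"
    with \<psi>.n_deriv[OF s] have d: "(frenet_n \<psi> has_vector_derivative
        - (norm (velocity \<psi> s) * curvature \<psi> s) *\<^sub>R frenet_t \<psi> s) (at s)" by simp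
    let ?w = "norm (velocity \<psi> s) * curvature \<psi> s"
    have "k s * curvature \<phi> s = ?w * (frenet_t \<psi> s \<bullet> frenet_t \<phi> s)"
      using inner_constant_imp_derivative_eq_0[OF \<phi>.open_I s n_inner(1) d \<phi>.t_deriv[OF s]]
        arc_length[OF s] by (simp add: k_def algebra_simps)
    moreover have "- (k s * torsion \<phi> s) = ?w * (frenet_t \<psi> s \<bullet> frenet_b \<phi> s)"
      using inner_constant_imp_derivative_eq_0[OF \<phi>.open_I s n_inner(2) d \<phi>.b_deriv[OF s]]
        arc_length[OF s] by (simp add: k_def algebra_simps)
    \<comment> \<open>The tangent components of \<psi> along \<open>t\<close> and \<open>b\<close>
      have ratio \<open>a\<close>, which eliminates the tangent of \<psi> from the two
      equations.\<close>
    ultimately have "k s * curvature \<phi> s = a * - (k s * torsion \<phi> s)"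
      unfolding t_inner(3)[OF s] by simp
    then have "k s * (curvature \<phi> s + a * torsion \<phi> s) = 0" by (simp add: algebra_simps)
    moreover have "k s \<noteq> 0" using k[OF s] \<psi>.n_unit[OF s] by auto
    ultimately have "c * (curvature \<phi> s + a * torsion \<phi> s) = 0" by simp
    with rel[OF s] show False by (simp add: algebra_simps)
  qed
  moreover have "\<exists>r. modified_N \<psi> s = r *\<^sub>R modified_N \<phi> s" if "s \<in> I" for s
    using k[OF that] \<phi>.curvature_nonzero[OF that]
    by (intro exI[of _ "curvature \<psi> s * k s / curvature \<phi> s"]) (simp add: modified_N_def)
  ultimately show ?thesis
    using \<phi>.curvature_nonzero \<psi>.curvature_nonzero torsion_nonzero
    by (simp add: bertrand_pair_def)
qed

end

theorem theorem4p4: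
  fixes \<phi> \<psi> :: "real \<Rightarrow> real^3" and \<delta> :: "real \<Rightarrow> real" and I :: "real set"
  assumes "open I" and "is_interval I"
    and "regular_C3_curve I \<phi>" and "regular_C3_curve I \<psi>"
    and arc_length: "\<forall>s\<in>I. norm (velocity \<phi> s) = 1"
    and "\<forall>s\<in>I. curvature \<phi> s \<noteq> 0" and "\<forall>s\<in>I. curvature \<psi> s \<noteq> 0"
    and "\<forall>s\<in>I. torsion \<phi> s \<noteq> 0"
    and offset: "\<forall>s\<in>I. \<psi> s = \<phi> s + \<delta> s *\<^sub>R modified_N \<phi> s"
    and distinct: "\<exists>s\<in>I. \<psi> s \<noteq> \<phi> s"
  shows "(bertrand_pair I \<phi> \<psi> \<longleftrightarrow>
            (\<exists>c \<theta>. c \<noteq> 0 \<and> sin \<theta> \<noteq> 0 \<and>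
               (\<forall>s\<in>I. \<delta> s = c / curvature \<phi> s) \<and>
               (\<forall>s\<in>I. tangent_angle \<phi> \<psi> s \<theta>) \<and>
               (\<forall>s\<in>I. c * curvature \<phi> s + cot \<theta> * c * torsion \<phi> s = 1)))
       \<and> (\<forall>c a. c \<noteq> 0 \<and>
               (\<forall>s\<in>I. \<delta> s = c / curvature \<phi> s) \<and>
               (\<forall>s\<in>I. c * curvature \<phi> s + a * c * torsion \<phi> s = 1)
             \<longrightarrow> bertrand_pair I \<phi> \<psi>)"
proof -
  interpret offset_curves I \<phi> \<psi> \<delta>
    using assms by unfold_locales auto
  have "\<exists>k. frenet_n \<psi> s = k *\<^sub>R frenet_n \<phi> s" if "bertrand_pair I \<phi> \<psi>" "s \<in> I" for s
  proof -
    from that obtain r where "modified_N \<psi> s = r *\<^sub>R modified_N \<phi> s"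
      unfolding bertrand_pair_def by blast
    \<comment> \<open>Dividing by the curvature of \<psi> passes from the modified normals to the
      unit normals.\<close>
    from arg_cong[OF this, of "\<lambda>x. x /\<^sub>R curvature \<psi> s"]
    have "frenet_n \<psi> s = (r * curvature \<phi> s / curvature \<psi> s) *\<^sub>R frenet_n \<phi> s"
      using \<psi>.curvature_nonzero[OF that(2)]
      by (simp add: modified_N_def divide_inverse mult.commute)
    then show ?thesis ..
  qed
  with parallel_normals_imp[OF _ distinct] linear_relation_imp_bertrand show ?thesis
    by blast
qed

end
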